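(* Let $\Gamma$ be an infinite, finitely generated group and let $X$ be a Cayley graph of $\Gamma$ associated to a finite set of generators. Then the metric boundary $\partial X$ contains at least two points, and all metric functionals of $X$ are unbounded, in the sense that for any metric functional $h$ of $X$ there is no upper bound of $|h(x)|$ as a function of $x\in X$.
   Context: The Cayley graph $X$ of $\Gamma$ with respect to a finite generating set $S$ is regarded as a metric space with the corresponding word metric: for $g,k\in\Gamma$, $d(g,k)$ is the least length of a word in $S\cup S^{-1}$ representing $g^{-1}k$ (an integer-valued, left-invariant distance on the vertices). The base point is the neutral element, $x_0=e$. For $x\in X$ define $h_x:X\to\mathbb{R}$ by $h_x(y)=d(y,x)-d(x_0,x)$. The metric compactification $\overline{X}$ is the closure of $\{h_x:x\in X\}$ in $\mathbb{R}^X$ with the topology of pointwise convergence; its elements are called metric functionals of $X$. The metric boundary is $\partial X:=\overline{X}\setminus X$, where $X$ is identified with $\{h_x:x\in X\}$ via the injective map $x\mapsto h_x$. *)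

theory Defs
  imports "HOL-Algebra.Generated_Groups" "HOL-Analysis.Function_Topology"
begin

text \<open>
  The least length of a word in \<open>S \<union> S\<inverse>\<close> representing \<open>g\<inverse>k\<close>.  As usual for
  \<open>LEAST\<close>, the value is meaningful only if such a word exists, e.g. if \<open>S\<close> generates \<open>G\<close>.
\<close>

definition word_dist :: "('a, 'b) monoid_scheme \<Rightarrow> 'a set \<Rightarrow> 'a \<Rightarrow> 'a \<Rightarrow> nat" where
  "word_dist G S g k =
     (LEAST n. \<exists>w. set w \<subseteq> S \<union> m_inv G ` S \<and> length w = n \<and>
                   foldr (mult G) w (one G) = m_inv G g \<otimes>\<^bsub>G\<^esub> k)"

text \<open>
  In the following, a metric space is given by a point set \<open>X\<close> and a distance \<open>d\<close>, and
  \<open>x\<^sub>0\<close> is a base point.  The function space \<open>\<real>\<^sup>X\<close> is represented by the functions that are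
  \<open>undefined\<close> outside \<open>X\<close>, so that equality of such functions is equality on \<open>X\<close>; on these,
  the product topology is the topology of pointwise convergence.
\<close>

definition point_functional :: "'a set \<Rightarrow> ('a \<Rightarrow> 'a \<Rightarrow> real) \<Rightarrow> 'a \<Rightarrow> 'a \<Rightarrow> 'a \<Rightarrow> real" where
  "point_functional X d x\<^sub>0 x = (\<lambda>y\<in>X. d y x - d x\<^sub>0 x)"

definition metric_compactification :: "'a set \<Rightarrow> ('a \<Rightarrow> 'a \<Rightarrow> real) \<Rightarrow> 'a \<Rightarrow> ('a \<Rightarrow> real) set" where
  "metric_compactification X d x\<^sub>0 =
     product_topology (\<lambda>_. euclideanreal) X closure_of (point_functional X d x\<^sub>0 ` X)"

definition metric_boundary :: "'a set \<Rightarrow> ('a \<Rightarrow> 'a \<Rightarrow> real) \<Rightarrow> 'a \<Rightarrow> ('a \<Rightarrow> real) set" where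
  "metric_boundary X d x\<^sub>0 = metric_compactification X d x\<^sub>0 - point_functional X d x\<^sub>0 ` X"

text \<open>
  The Cayley graph of \<open>G\<close> with respect to \<open>S\<close>, as a metric space, is the vertex set
  \<open>carrier G\<close> with the word metric; its base point is the neutral element.
\<close>

definition cayley_metric_functionals :: "('a, 'b) monoid_scheme \<Rightarrow> 'a set \<Rightarrow> ('a \<Rightarrow> real) set" where
  "cayley_metric_functionals G S =
     metric_compactification (carrier G) (\<lambda>g k. real (word_dist G S g k)) (one G)"

definition cayley_metric_boundary :: "('a, 'b) monoid_scheme \<Rightarrow> 'a set \<Rightarrow> ('a \<Rightarrow> real) set" where
  "cayley_metric_boundary G S =
     metric_boundary (carrier G) (\<lambda>g k. real (word_dist G S g k)) (one G)"

end

theory Submission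
  imports Defs "HOL-Analysis.T1_Spaces"
begin

text \<open>
  Two facts carry the proof. Balls are finite and distances are integers, so an
  infinite set of points accumulates at a functional that coincides, on each prescribed finite set
  of points, with infinitely many of the functionals \<open>h\<^sub>x\<close>
  (\<open>accumulation_functional_in_boundary\<close>).
  And since a geodesic from the base point to a far-away \<open>x\<close> passes through each radius \<open>n\<close>, the
  functional \<open>h\<^sub>x\<close> takes the value \<open>-n\<close> on the finite ball of radius \<open>n\<close>; this survives in every
  limit of such functionals, whereas a limit of \<open>h\<^sub>x\<close> with \<open>x\<close> staying close is unbounded
  above because the group is infinite. This gives unboundedness, and it shows that the accumulation
  functionals above are not of the form \<open>h\<^sub>z\<close>, so that they lie in the boundary.

  Suppose that the boundary were a single point \<open>h\<close>. Then, for each finite set \<open>K\<close>, the functional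
  \<open>h\<^sub>x\<close> coincides with \<open>h\<close> on \<open>K\<close> for all but finitely many \<open>x\<close>
  (\<open>unique_boundary_point_cofinite\<close>). As \<open>h\<^sub>g\<^sub>x (g y) - h\<^sub>g\<^sub>x (g) = h\<^sub>x (y)\<close> by left invariance,
  \<open>h\<close> is a homomorphism to the reals (\<open>unique_boundary_point_hom\<close>). Choose \<open>x \<noteq> e\<close> such that \<open>h\<^sub>x\<close>
  agrees with \<open>h\<close> on the unit ball. A geodesic word for \<open>x\<close> begins with a letter at which \<open>h\<^sub>x\<close>,
  and hence \<open>h\<close>, is \<open>-1\<close>; let \<open>t\<close> be its inverse. Since \<open>\<bar>h\<bar>\<close> is bounded by the word length,
  \<open>h (t\<^sup>n) = n\<close> forces \<open>t\<^sup>n\<close> to have length \<open>n\<close>. So the powers of \<open>t\<close> run along a geodesic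
  through \<open>t\<close>, and \<open>h\<^sub>x (t) = -1\<close> for each \<open>x = t\<^sup>n\<close> with \<open>n \<ge> 1\<close>. Infinitely many such \<open>x\<close>
  cannot all be exceptions to agreement at \<open>t\<close>, so \<open>h (t) = -1\<close>, although \<open>h (t) = 1\<close>.
\<close>

section \<open>Functionals on proper geodesic spaces with integer distances\<close>

text \<open>
  What the word metric shares with the vertex set of any connected locally finite graph. The
  distance is only constrained on \<open>X\<close>, because \<open>word_dist\<close> is meaningless outside the carrier.
\<close>

locale proper_integer_geodesic_space =
  fixes X :: "'a set" and d :: "'a \<Rightarrow> 'a \<Rightarrow> nat" and b :: 'a
  assumes base_in: "b \<in> X"
    and dist_zero: "\<lbrakk>x \<in> X; y \<in> X\<rbrakk> \<Longrightarrow> d x y = 0 \<longleftrightarrow> x = y"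
    and dist_sym: "\<lbrakk>x \<in> X; y \<in> X\<rbrakk> \<Longrightarrow> d x y = d y x"
    and dist_triangle: "\<lbrakk>x \<in> X; y \<in> X; z \<in> X\<rbrakk> \<Longrightarrow> d x z \<le> d x y + d y z"
    and finite_ball: "finite {y \<in> X. d b y \<le> r}"
    and geodesic: "\<lbrakk>x \<in> X; n \<le> d b x\<rbrakk> \<Longrightarrow> \<exists>y\<in>X. d b y = n \<and> d y x = d b x - n"
begin

abbreviation functional :: "'a \<Rightarrow> 'a \<Rightarrow> real" where
  "functional \<equiv> point_functional X (\<lambda>x y. real (d x y)) b"

abbreviation compactification :: "('a \<Rightarrow> real) set" where
  "compactification \<equiv> metric_compactification X (\<lambda>x y. real (d x y)) b"

abbreviation boundary :: "('a \<Rightarrow> real) set" where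
  "boundary \<equiv> metric_boundary X (\<lambda>x y. real (d x y)) b"

lemma functional_eq: "y \<in> X \<Longrightarrow> functional x y = real (d y x) - real (d b x)"
  by (simp add: point_functional_def)

lemma abs_functional_le:
  assumes "x \<in> X" "y \<in> X"
  shows "\<bar>functional x y\<bar> \<le> real (d b y)"
proof -
  have "d y x \<le> d b y + d b x" "d b x \<le> d b y + d y x"
    using dist_triangle[of y b x] dist_triangle[of b y x] dist_sym[of b y] assms base_in by auto
  then show ?thesis
    using assms by (simp add: functional_eq)
qed

lemma inj_on_functional: "inj_on functional X"
proof (rule inj_onI)
  fix x z assume xz: "x \<in> X" "z \<in> X" and eq: "functional x = functional z"
  have "d x x = 0" "d z z = 0" "d z x = d x z"
    using xz dist_zero dist_sym by auto
  then have "d x z = 0"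
    using fun_cong[OF eq, of x] fun_cong[OF eq, of z] xz by (simp add: functional_eq)
  then show "x = z"
    using xz dist_zero by simp
qed

lemma far_point:
  assumes "infinite A" "A \<subseteq> X"
  obtains x where "x \<in> A" "n < d b x"
proof -
  have "\<not> A \<subseteq> {y \<in> X. d b y \<le> n}"
    using assms(1) finite_ball finite_subset by blast
  then show thesis
    using that assms(2) by force
qed

text \<open>
  Since \<open>\<bar>h\<^sub>x (y)\<bar> \<le> d b y\<close>, the value \<open>-n\<close> is the least possible on the ball of radius \<open>n\<close>; a
  geodesic to \<open>x\<close> attains it.
\<close>

lemma functional_geodesic_value:
  assumes "x \<in> X" "n \<le> d b x"
  obtains y where "y \<in> X" "d b y = n" "functional x y = - real n"
  using geodesic[OF assms] assms(2) that by (force simp: functional_eq of_nat_diff)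

section \<open>Pointwise convergence\<close>

lemma openin_finite_nbhd:
  assumes "finite K" "f \<in> extensional X"
  obtains U where "openin (product_topology (\<lambda>_. euclideanreal) X) U" "f \<in> U"
    "\<And>u y. \<lbrakk>u \<in> U; y \<in> K; y \<in> X\<rbrakk> \<Longrightarrow> \<bar>u y - f y\<bar> < 1"
proof
  let ?V = "\<lambda>y. if y \<in> K then {f y - 1<..<f y + 1} else UNIV"
  let ?U = "PiE X ?V"
  have "{i \<in> X. ?V i \<noteq> UNIV} \<subseteq> K"
    by auto
  then show "openin (product_topology (\<lambda>_. euclideanreal) X) ?U"
    using assms(1) by (intro product_topology_basis) (auto intro: finite_subset)
  show "f \<in> ?U"
    using assms(2) by (auto simp: PiE_iff)
  show "\<bar>u y - f y\<bar> < 1" if "u \<in> ?U" "y \<in> K" "y \<in> X" for u y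
    using that by (auto simp: PiE_iff dest!: bspec)
qed

text \<open>
  A radius \<open>R\<close> beyond a bound \<open>C\<close> and one point \<open>p\<close> outside the ball of radius \<open>3R\<close> detect
  unboundedness on a finite set: \<open>h\<^sub>x\<close> is very negative in the ball if \<open>x\<close> is outside it, and
  very positive at \<open>p\<close> otherwise.
\<close>

proposition metric_functional_unbounded:
  assumes "infinite X" "h \<in> compactification"
  shows "\<nexists>C. \<forall>x\<in>X. \<bar>h x\<bar> \<le> C"
proof
  assume "\<exists>C. \<forall>x\<in>X. \<bar>h x\<bar> \<le> C"
  then obtain C where C: "\<And>x. x \<in> X \<Longrightarrow> \<bar>h x\<bar> \<le> C"
    by blast
  obtain R :: nat where R: "C + 1 < real R"
    using reals_Archimedean2 by blast
  obtain p where p: "p \<in> X" "3 * R < d b p"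
    using far_point[OF assms(1) order_refl] .
  have "h \<in> extensional X"
    using assms(2) closure_of_subset_topspace
    by (fastforce simp: metric_compactification_def PiE_iff)
  with finite_ball obtain U where U: "openin (product_topology (\<lambda>_. euclideanreal) X) U" "h \<in> U"
    and near: "\<And>u y. \<lbrakk>u \<in> U; y \<in> insert p {y \<in> X. d b y \<le> R}; y \<in> X\<rbrakk> \<Longrightarrow> \<bar>u y - h y\<bar> < 1"
    using openin_finite_nbhd[of "insert p {y \<in> X. d b y \<le> R}" h] by blast
  obtain x where x: "x \<in> X" "functional x \<in> U"
    using assms(2) U unfolding metric_compactification_def in_closure_of by blast
  show False
  proof (cases "R \<le> d b x")
    case True
    then obtain y where "y \<in> X" "d b y = R" "functional x y = - real R"
      using functional_geodesic_value x(1) by blast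
    then show False
      using near[OF x(2), of y] C[of y] R by auto
  next
    case False
    have "d b p \<le> d b x + d p x"
      using dist_triangle[of b x p] dist_sym[of p x] p(1) x(1) base_in by simp
    with False p have "real R \<le> functional x p"
      by (simp add: functional_eq)
    then show False
      using near[OF x(2), of p] C[of p] R p(1) by auto
  qed
qed

text \<open>
  All functionals lie in the product of the finite sets of integers of modulus at most \<open>d b y\<close>. This
  box is compact, and its points are integer-valued, so that being close to an accumulation
  point on a finite set means being equal to it there.
\<close>

proposition accumulation_functional_in_boundary:
  assumes "infinite A" "A \<subseteq> X"
  obtains h where "h \<in> boundary"
    "\<And>K. \<lbrakk>finite K; K \<subseteq> X\<rbrakk> \<Longrightarrow> infinite {x \<in> A. \<forall>y\<in>K. functional x y = h y}"
proof -
  let ?T = "product_topology (\<lambda>_. euclideanreal) X"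
  define box where "box = PiE X (\<lambda>y. real_of_int ` {- int (d b y)..int (d b y)})"
  have "compactin ?T box"
    unfolding box_def by (simp add: compactin_PiE finite_imp_compact)
  have in_box: "functional x \<in> box" if "x \<in> X" for x
  proof -
    have "functional x y \<in> real_of_int ` {- int (d b y)..int (d b y)}" if "y \<in> X" for y
      using abs_functional_le[OF \<open>x \<in> X\<close> that] that
      by (intro image_eqI[where x = "int (d y x) - int (d b x)"]) (auto simp: functional_eq)
    then show ?thesis
      by (auto simp: box_def PiE_iff point_functional_def)
  qed
  have inj: "inj_on functional A"
    using inj_on_functional assms(2) inj_on_subset by blast
  have inf: "infinite (functional ` A)"
    using assms(1) inj finite_image_iff by blast
  have "functional ` A \<subseteq> box"
    using in_box assms(2) by blast
  then obtain h where "h \<in> box" and derived: "h \<in> ?T derived_set_of (functional ` A)"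
    using compactin_imp_Bolzano_Weierstrass[OF \<open>compactin ?T box\<close>, of "functional ` A"] inf by blast
  have agree: "infinite {x \<in> A. \<forall>y\<in>K. functional x y = h y}" if K: "finite K" "K \<subseteq> X" for K
  proof -
    have "h \<in> extensional X"
      using \<open>h \<in> box\<close> by (simp add: box_def PiE_iff)
    then obtain U where U: "openin ?T U" "h \<in> U"
      and near: "\<And>u y. \<lbrakk>u \<in> U; y \<in> K; y \<in> X\<rbrakk> \<Longrightarrow> \<bar>u y - h y\<bar> < 1"
      using openin_finite_nbhd[OF K(1)] by blast
    have "t1_space ?T"
      by (simp add: t1_space_product_topology t1_space_euclidean)
    then have "infinite (functional ` A \<inter> U)"
      using derived U by (simp add: t1_space_derived_set_of_infinite_openin)
    moreover have "functional ` A \<inter> U \<subseteq> functional ` {x \<in> A. \<forall>y\<in>K. functional x y = h y}"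
    proof clarsimp
      fix x assume x: "x \<in> A" "functional x \<in> U"
      have "functional x y = h y" if "y \<in> K" for y
      proof -
        have "y \<in> X" "x \<in> X"
          using that K x assms(2) by auto
        then obtain m n :: int where mn: "functional x y = m" "h y = n"
          using in_box[of x] \<open>h \<in> box\<close> unfolding box_def by (blast dest: PiE_mem)
        have "\<bar>real_of_int (m - n)\<bar> < 1"
          using near[OF x(2) \<open>y \<in> K\<close> \<open>y \<in> X\<close>] mn by simp
        then have "m = n"
          by linarith
        then show ?thesis
          using mn by simp
      qed
      then show "functional x \<in> functional ` {x \<in> A. \<forall>y\<in>K. functional x y = h y}"
        using x(1) by blast
    qed
    ultimately show ?thesis
      using finite_surj by blast
  qed
  \<comment> \<open>\<open>h\<close> reaches \<open>-n\<close> for each \<open>n\<close>, but \<open>h\<^sub>z\<close> is at least \<open>- d b z\<close>.\<close>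
  have "h \<notin> functional ` X"
  proof
    assume "h \<in> functional ` X"
    then obtain z where z: "z \<in> X" "h = functional z"
      by blast
    define n where "n = Suc (d b z)"
    define A' where "A' = {x \<in> A. \<forall>y\<in>{y \<in> X. d b y \<le> n}. functional x y = h y}"
    have "A' \<subseteq> X"
      using assms(2) by (auto simp: A'_def)
    moreover have "infinite A'"
      unfolding A'_def by (rule agree) (auto simp: finite_ball)
    ultimately obtain x where "x \<in> A'" "n < d b x"
      using far_point by metis
    then have "x \<in> X" "n \<le> d b x" and x: "\<And>y. \<lbrakk>y \<in> X; d b y \<le> n\<rbrakk> \<Longrightarrow> functional x y = h y"
      using \<open>A' \<subseteq> X\<close> by (auto simp: A'_def)
    then obtain y where y: "y \<in> X" "d b y = n" "functional x y = - real n"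
      using functional_geodesic_value by metis
    then have "real (d y z) - real (d b z) = - real n"
      using x[of y] z by (simp add: functional_eq)
    then show False
      by (simp add: n_def)
  qed
  moreover have "h \<in> ?T derived_set_of (functional ` X)"
    using derived derived_set_of_mono[of "functional ` A" "functional ` X" ?T] assms(2) by blast
  then have "h \<in> compactification"
    unfolding metric_compactification_def in_closure_of in_derived_set_of by blast
  ultimately have "h \<in> boundary"
    by (simp add: metric_boundary_def)
  then show thesis
    using agree that by blast
qed

text \<open>
  Infinitely many exceptions would accumulate at a boundary point that differs from \<open>h\<close> on \<open>K\<close>.
\<close>

corollary unique_boundary_point_cofinite:
  assumes unique: "\<And>f. f \<in> boundary \<Longrightarrow> f = h"
    and "finite K" "K \<subseteq> X"
  shows "finite {x \<in> X. \<exists>y\<in>K. functional x y \<noteq> h y}" (is "finite ?A")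
proof (rule ccontr)
  assume "infinite ?A"
  from accumulation_functional_in_boundary[OF this] obtain f where "f \<in> boundary"
    and "\<And>L. \<lbrakk>finite L; L \<subseteq> X\<rbrakk> \<Longrightarrow> infinite {x \<in> ?A. \<forall>y\<in>L. functional x y = f y}"
    by blast
  then have "infinite {x \<in> ?A. \<forall>y\<in>K. functional x y = h y}"
    using unique assms(2,3) by blast
  moreover have "{x \<in> ?A. \<forall>y\<in>K. functional x y = h y} = {}"
    by blast
  ultimately show False
    by (simp only: finite.emptyI not_True_eq_False)
qed

end

section \<open>The word metric\<close>

locale finitely_generated_group = group G for G :: "('a, 'b) monoid_scheme" (structure) +
  fixes S :: "'a set"
  assumes finite_gens: "finite S" and gens_closed: "S \<subseteq> carrier G"
    and gens_generate: "generate G S = carrier G"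
begin

abbreviation letters :: "'a set" where "letters \<equiv> S \<union> m_inv G ` S"

abbreviation word_prod :: "'a list \<Rightarrow> 'a" where "word_prod w \<equiv> foldr (\<otimes>) w \<one>"

abbreviation wd :: "'a \<Rightarrow> 'a \<Rightarrow> nat" where "wd \<equiv> word_dist G S"

lemma letters_closed: "letters \<subseteq> carrier G"
  using gens_closed by auto

lemma word_prod_closed: "set w \<subseteq> letters \<Longrightarrow> word_prod w \<in> carrier G"
  using letters_closed by (induction w) auto

lemma word_prod_append:
  "\<lbrakk>set u \<subseteq> letters; set v \<subseteq> letters\<rbrakk> \<Longrightarrow> word_prod (u @ v) = word_prod u \<otimes> word_prod v"
  using letters_closed word_prod_closed by (induction u) (auto simp: m_assoc subset_iff)

lemma inv_letter: "s \<in> letters \<Longrightarrow> inv s \<in> letters"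
  using gens_closed by auto

lemma word_inverse:
  assumes "set w \<subseteq> letters"
  shows "\<exists>v. set v \<subseteq> letters \<and> length v = length w \<and> word_prod v = inv (word_prod w)"
  using assms
proof (induction w)
  case Nil
  then show ?case by auto
next
  case (Cons s w)
  then obtain v where v: "set v \<subseteq> letters" "length v = length w" "word_prod v = inv (word_prod w)"
    by auto
  have s: "s \<in> letters" "s \<in> carrier G" "inv s \<in> letters"
    using Cons.prems letters_closed inv_letter[of s] by auto
  have "word_prod (v @ [inv s]) = inv (word_prod (s # w))"
    using v s Cons.prems word_prod_append[of v "[inv s]"] word_prod_closed[of w]
    by (simp add: inv_mult_group)
  then show ?case
    using v s by (intro exI[of _ "v @ [inv s]"]) auto
qed

lemma ex_word:
  assumes "g \<in> carrier G"
  shows "\<exists>w. set w \<subseteq> letters \<and> word_prod w = g"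
proof -
  have "g \<in> generate G S"
    using assms gens_generate by simp
  then show ?thesis
  proof (induction rule: generate.induct)
    case one
    show ?case by (intro exI[of _ "[]"]) simp
  next
    case (incl h)
    then show ?case using gens_closed by (intro exI[of _ "[h]"]) auto
  next
    case (inv h)
    then show ?case using gens_closed by (intro exI[of _ "[inv h]"]) auto
  next
    case (eng h1 h2)
    then obtain u v where "set u \<subseteq> letters" "word_prod u = h1" "set v \<subseteq> letters" "word_prod v = h2"
      by blast
    then show ?case
      using word_prod_append by (intro exI[of _ "u @ v"]) auto
  qed
qed

lemma word_dist_le:
  "\<lbrakk>set w \<subseteq> letters; word_prod w = inv g \<otimes> k\<rbrakk> \<Longrightarrow> wd g k \<le> length w"
  unfolding word_dist_def by (rule Least_le) auto

lemma geodesic_word: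
  assumes "g \<in> carrier G" "k \<in> carrier G"
  obtains w where "set w \<subseteq> letters" "length w = wd g k" "word_prod w = inv g \<otimes> k"
proof -
  obtain w where "set w \<subseteq> letters" "word_prod w = inv g \<otimes> k"
    using ex_word[of "inv g \<otimes> k"] assms by auto
  then have "\<exists>n w. set w \<subseteq> letters \<and> length w = n \<and> word_prod w = inv g \<otimes> k"
    by blast
  from LeastI_ex[OF this] that show thesis
    unfolding word_dist_def by blast
qed

lemma word_dist_left_invariant:
  assumes "g \<in> carrier G" "x \<in> carrier G" "y \<in> carrier G"
  shows "wd (g \<otimes> x) (g \<otimes> y) = wd x y"
proof -
  have "inv g \<otimes> (g \<otimes> y) = y"
    using assms by (simp add: m_assoc[symmetric])
  then have "inv (g \<otimes> x) \<otimes> (g \<otimes> y) = inv x \<otimes> y"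
    using assms by (simp add: inv_mult_group m_assoc)
  then show ?thesis
    by (simp add: word_dist_def)
qed

lemma word_dist_eq_0:
  assumes "g \<in> carrier G" "k \<in> carrier G"
  shows "wd g k = 0 \<longleftrightarrow> g = k"
proof
  assume "wd g k = 0"
  then have "inv g \<otimes> k = \<one>"
    using geodesic_word[OF assms] by (metis foldr_Nil id_apply length_0_conv)
  then show "g = k"
    using assms by (metis inv_closed inv_equality inv_inv)
next
  assume "g = k"
  then show "wd g k = 0"
    using word_dist_le[of "[]" g k] assms by simp
qed

lemma word_dist_commute_le:
  assumes "g \<in> carrier G" "k \<in> carrier G"
  shows "wd k g \<le> wd g k"
proof -
  obtain w where w: "set w \<subseteq> letters" "length w = wd g k" "word_prod w = inv g \<otimes> k"
    using geodesic_word[OF assms] .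
  then obtain v where "set v \<subseteq> letters" "length v = length w" "word_prod v = inv (inv g \<otimes> k)"
    using word_inverse by metis
  then show ?thesis
    using word_dist_le[of v k g] w assms by (simp add: inv_mult_group)
qed

lemma word_dist_triangle:
  assumes "x \<in> carrier G" "y \<in> carrier G" "z \<in> carrier G"
  shows "wd x z \<le> wd x y + wd y z"
proof -
  obtain u where u: "set u \<subseteq> letters" "length u = wd x y" "word_prod u = inv x \<otimes> y"
    using geodesic_word assms(1,2) .
  obtain v where v: "set v \<subseteq> letters" "length v = wd y z" "word_prod v = inv y \<otimes> z"
    using geodesic_word assms(2,3) .
  have "y \<otimes> (inv y \<otimes> z) = z"
    using assms by (simp add: m_assoc[symmetric])
  then have "(inv x \<otimes> y) \<otimes> (inv y \<otimes> z) = inv x \<otimes> z"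
    using assms by (simp add: m_assoc)
  then have "word_prod (u @ v) = inv x \<otimes> z"
    using word_prod_append u v by metis
  then show ?thesis
    using word_dist_le[of "u @ v" x z] u v by simp
qed

lemma finite_word_ball: "finite {y \<in> carrier G. wd \<one> y \<le> r}"
proof -
  have "y \<in> word_prod ` {w. set w \<subseteq> letters \<and> length w \<le> r}"
    if "y \<in> carrier G" "wd \<one> y \<le> r" for y
    using geodesic_word[of \<one> y] that by force
  moreover have "finite (word_prod ` {w. set w \<subseteq> letters \<and> length w \<le> r})"
    using finite_gens by (intro finite_imageI finite_lists_length_le) auto
  ultimately show ?thesis
    by (auto intro: finite_subset)
qed

text \<open>The prefixes of a shortest word for \<open>x\<close> are the points of a geodesic.\<close>

lemma word_dist_geodesic:
  assumes "x \<in> carrier G" "n \<le> wd \<one> x"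
  shows "\<exists>y\<in>carrier G. wd \<one> y = n \<and> wd y x = wd \<one> x - n"
proof -
  obtain w where w: "set w \<subseteq> letters" "length w = wd \<one> x" "word_prod w = x"
    using geodesic_word[of \<one> x] assms by auto
  define y where "y = word_prod (take n w)"
  have sub: "set (take n w) \<subseteq> letters" "set (drop n w) \<subseteq> letters"
    using w(1) set_take_subset set_drop_subset by fast+
  have yz: "y \<in> carrier G" "word_prod (drop n w) \<in> carrier G"
    using sub word_prod_closed unfolding y_def by blast+
  have "x = y \<otimes> word_prod (drop n w)"
    using word_prod_append[OF sub] w(3) unfolding y_def by simp
  then have "word_prod (drop n w) = inv y \<otimes> x"
    using yz by (simp add: m_assoc[symmetric])
  then have "wd y x \<le> wd \<one> x - n"
    using word_dist_le[OF sub(2), of y x] w(2) by simp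
  moreover have "wd \<one> y \<le> n"
    using word_dist_le[OF sub(1), of \<one> y] yz assms(2) w(2) unfolding y_def by simp
  ultimately show ?thesis
    using word_dist_triangle[of \<one> y x] assms yz by (intro bexI[of _ y]) auto
qed

sublocale proper_integer_geodesic_space "carrier G" wd \<one>
proof
  show "wd x y = wd y x" if "x \<in> carrier G" "y \<in> carrier G" for x y
    using that word_dist_commute_le by (simp add: antisym)
qed (use word_dist_eq_0 word_dist_triangle finite_word_ball word_dist_geodesic in auto)

section \<open>A one-point boundary is impossible\<close>

lemma functional_left_translate:
  assumes "g \<in> carrier G" "x \<in> carrier G" "y \<in> carrier G"
  shows "functional (g \<otimes> x) (g \<otimes> y) - functional (g \<otimes> x) g = functional x y"
  using word_dist_left_invariant[of g \<one> x] word_dist_left_invariant[of g y x] assms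
  by (simp add: functional_eq)

text \<open>
  Translation by \<open>g\<close> permutes the group, so it preserves cofiniteness: for some \<open>x\<close>, both \<open>h\<^sub>x\<close>
  agrees with \<open>h\<close> at \<open>y\<close> and \<open>h\<^sub>g\<^sub>x\<close> agrees with \<open>h\<close> at \<open>g\<close> and \<open>g y\<close>.
\<close>

lemma unique_boundary_point_hom:
  assumes "infinite (carrier G)" and unique: "\<And>f. f \<in> boundary \<Longrightarrow> f = h"
    and g: "g \<in> carrier G" and y: "y \<in> carrier G"
  shows "h (g \<otimes> y) = h g + h y"
proof -
  let ?B = "\<lambda>K. {x \<in> carrier G. \<exists>y\<in>K. functional x y \<noteq> h y}"
  have fin: "finite (?B K)" if "finite K" "K \<subseteq> carrier G" for K
    using unique that by (rule unique_boundary_point_cofinite)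
  have "finite {x \<in> carrier G. g \<otimes> x \<in> ?B {g, g \<otimes> y}}"
  proof (rule inj_on_finite)
    show "inj_on ((\<otimes>) g) {x \<in> carrier G. g \<otimes> x \<in> ?B {g, g \<otimes> y}}"
      using g by (auto intro!: inj_onI)
    show "(\<otimes>) g ` {x \<in> carrier G. g \<otimes> x \<in> ?B {g, g \<otimes> y}} \<subseteq> ?B {g, g \<otimes> y}"
      by blast
    show "finite (?B {g, g \<otimes> y})"
      using g y by (intro fin) auto
  qed
  moreover have "finite (?B {y})"
    using y by (intro fin) auto
  ultimately have "\<not> carrier G \<subseteq> {x \<in> carrier G. g \<otimes> x \<in> ?B {g, g \<otimes> y}} \<union> ?B {y}"
    using assms(1) finite_subset by blast
  then obtain x where "x \<in> carrier G" "functional x y = h y"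
    "functional (g \<otimes> x) g = h g" "functional (g \<otimes> x) (g \<otimes> y) = h (g \<otimes> y)"
    using g by auto
  then show ?thesis
    using functional_left_translate[of g x y] g y by simp
qed

proposition boundary_two_points:
  assumes inf: "infinite (carrier G)"
  shows "\<exists>h\<^sub>1\<in>boundary. \<exists>h\<^sub>2\<in>boundary. h\<^sub>1 \<noteq> h\<^sub>2"
proof (rule ccontr)
  assume no_two: "\<not> ?thesis"
  obtain h where "h \<in> boundary"
    using accumulation_functional_in_boundary[OF inf order_refl] by blast
  with no_two have unique: "f = h" if "f \<in> boundary" for f
    using that by blast
  have fin: "finite {x \<in> carrier G. \<exists>y\<in>K. functional x y \<noteq> h y}"
    if "finite K" "K \<subseteq> carrier G" for K
    using unique that by (rule unique_boundary_point_cofinite)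
  \<comment> \<open>The exceptions to agreement on \<open>K\<close> and the point \<open>\<one>\<close> together are too few to fill \<open>A\<close>.\<close>
  have generic: "\<exists>x\<in>A. 1 \<le> wd \<one> x \<and> (\<forall>y\<in>K. functional x y = h y)"
    if "infinite A" "A \<subseteq> carrier G" "finite K" "K \<subseteq> carrier G" for A K
  proof -
    define A' where "A' = A - {x \<in> carrier G. \<exists>y\<in>K. functional x y \<noteq> h y}"
    have "infinite A'"
      unfolding A'_def using that(1) fin[OF that(3,4)] by (rule Diff_infinite_finite[rotated])
    moreover have "A' \<subseteq> carrier G"
      using that(2) by (auto simp: A'_def)
    ultimately obtain x where x: "x \<in> A'" "0 < wd \<one> x"
      by (rule far_point)
    with that(2) have "x \<in> A" "\<forall>y\<in>K. functional x y = h y"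
      by (auto simp: A'_def)
    with x(2) show ?thesis
      by (intro bexI[of _ x]) simp_all
  qed
  have hom: "h (g \<otimes> y) = h g + h y" if "g \<in> carrier G" "y \<in> carrier G" for g y
    using unique_boundary_point_hom[OF inf unique that] .
  have h_one: "h \<one> = 0"
    using hom[of \<one> \<one>] by simp
  have h_le: "\<bar>h y\<bar> \<le> real (wd \<one> y)" if y: "y \<in> carrier G" for y
  proof -
    obtain x where "x \<in> carrier G" "functional x y = h y"
      using generic[OF inf order_refl, of "{y}"] y by blast
    then show ?thesis
      using abs_functional_le[of x y] y by simp
  qed
  obtain x where x: "x \<in> carrier G" "1 \<le> wd \<one> x"
    and agree: "\<And>y. \<lbrakk>y \<in> carrier G; wd \<one> y \<le> 1\<rbrakk> \<Longrightarrow> functional x y = h y"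
    using generic[OF inf order_refl finite_word_ball[of 1]] by blast
  obtain s where s: "s \<in> carrier G" "wd \<one> s = 1" "functional x s = - 1"
    using functional_geodesic_value[OF x] by auto
  define t where "t = inv s"
  have t: "t \<in> carrier G"
    using s by (simp add: t_def)
  have "h s = - 1"
    using agree[of s] s by simp
  moreover have "h t + h s = 0"
    using hom[OF t s(1)] s(1) h_one by (simp add: t_def)
  ultimately have h_t: "h t = 1"
    by simp
  have t_length: "wd \<one> t = 1"
    using word_dist_left_invariant[OF t, of \<one> s] dist_sym[of t \<one>] s t by (simp add: t_def)
  have h_pow: "h (t [^] n) = real n" for n :: nat
    using t h_t h_one hom by (induction n) auto
  have length_pow: "wd \<one> (t [^] n) = n" for n :: nat
  proof (rule antisym)
    show "wd \<one> (t [^] n) \<le> n"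
    proof (induction n)
      case (Suc n)
      have "wd (t [^] n) (t [^] n \<otimes> t) = 1"
        using word_dist_left_invariant[of "t [^] n" \<one> t] t t_length by simp
      then show ?case
        using Suc word_dist_triangle[of \<one> "t [^] n" "t [^] Suc n"] t by simp
    qed (simp add: word_dist_eq_0)
    show "n \<le> wd \<one> (t [^] n)"
      using h_le[of "t [^] n"] h_pow[of n] t by simp
  qed
  have "inj (\<lambda>n::nat. t [^] n)"
    by (rule injI) (metis length_pow)
  then have "infinite (range (\<lambda>n::nat. t [^] n))"
    using finite_imageD infinite_UNIV_nat by blast
  moreover have "range (\<lambda>n::nat. t [^] n) \<subseteq> carrier G"
    using t by auto
  ultimately obtain n :: nat where n: "1 \<le> wd \<one> (t [^] n)" "functional (t [^] n) t = h t"
    using generic[of "range (\<lambda>n::nat. t [^] n)" "{t}"] t by blast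
  then obtain m where m: "n = Suc m"
    using length_pow[of n] by (cases n) auto
  have "t [^] n = t \<otimes> t [^] m"
    using m t nat_pow_Suc2 by simp
  then have "wd t (t [^] n) = m"
    using word_dist_left_invariant[of t \<one> "t [^] m"] t length_pow by simp
  then have "functional (t [^] n) t = - 1"
    using functional_eq t length_pow[of n] m by simp
  with n h_t show False
    by simp
qed

end

theorem theorem15:
  fixes G :: "('a, 'b) monoid_scheme" and S :: "'a set"
  assumes "group G"
    and "infinite (carrier G)"
    and "finite S"
    and "S \<subseteq> carrier G"
    and "generate G S = carrier G"
  shows "(\<exists>h\<^sub>1 \<in> cayley_metric_boundary G S. \<exists>h\<^sub>2 \<in> cayley_metric_boundary G S. h\<^sub>1 \<noteq> h\<^sub>2) \<and>
         (\<forall>h \<in> cayley_metric_functionals G S. \<not> (\<exists>C::real. \<forall>x \<in> carrier G. \<bar>h x\<bar> \<le> C))"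
proof -
  interpret finitely_generated_group G S
    using assms by (simp add: finitely_generated_group_def finitely_generated_group_axioms_def)
  show ?thesis
    using boundary_two_points[OF assms(2)] metric_functional_unbounded[OF assms(2)]
    unfolding cayley_metric_boundary_def cayley_metric_functionals_def by blast
qed

end
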